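(* Let $(x_k)_{k\ge0}$ be generated by Anderson acceleration AA(1) from an initial guess $x_0\in\mathbb{R}^n$, applied to the linear fixed-point function $q(x)=Mx+b$, with residuals $r_k=x_k-q(x_k)$. Then for all $k\ge 1$: (i) if $r_k\ne r_{k-1}$, $$ r_{k+1}=\frac{1}{(r_k-r_{k-1})^T(r_k-r_{k-1})}\,M\big(-r_kr_{k-1}^T+(r_kr_{k-1}^T)^T\big)(r_k-r_{k-1}); $$ (ii) if $r_k=r_{k-1}$, $r_{k+1}=Mr_k$.
   Context: Setting: $M\in\mathbb{R}^{n\times n}$, $b\in\mathbb{R}^n$, $q(x)=Mx+b$, $A=I-M$ is nonsingular and $M\neq 0$. $\|\cdot\|$ is the 2-norm. The residual is $r(x)=x-q(x)=Ax-b$ and $r_k=r(x_k)$. AA(1): given $x_0\in\mathbb{R}^n$, set $x_1=q(x_0)$ and for $k\ge1$ $$x_{k+1}=(1+\beta_k)q(x_k)-\beta_kq(x_{k-1}),\qquad \beta_k=\frac{-r_k^T(r_k-r_{k-1})}{\|r_k-r_{k-1}\|^2}\ \text{ if } r_k\ne r_{k-1},$$ and $\beta_k=0$ if $r_k=r_{k-1}$. *)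

theory Defs
  imports "HOL-Analysis.Analysis"
begin

definition residual :: "('a::real_inner \<Rightarrow> 'a) \<Rightarrow> 'a \<Rightarrow> 'a" where
  "residual q x = x - q x"

(* The AA(1) coefficient: u is the previous residual, v the current one. *)
definition AA1_coeff :: "'a::real_inner \<Rightarrow> 'a \<Rightarrow> real" where
  "AA1_coeff u v = (if v \<noteq> u then - (v \<bullet> (v - u)) / (norm (v - u))\<^sup>2 else 0)"

fun AA1 :: "('a::real_inner \<Rightarrow> 'a) \<Rightarrow> 'a \<Rightarrow> nat \<Rightarrow> 'a" where
  "AA1 q x0 0 = x0"
| "AA1 q x0 (Suc 0) = q x0"
| "AA1 q x0 (Suc (Suc k)) =
     (let y = AA1 q x0 k; z = AA1 q x0 (Suc k);
          \<beta> = AA1_coeff (residual q y) (residual q z)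
      in (1 + \<beta>) *\<^sub>R q z - \<beta> *\<^sub>R q y)"

(* The inner dimension of a column-times-row product has to be the one-element type;
   left open, it would be an arbitrary size and scale the result. *)
definition outer_product :: "real ^ 'm \<Rightarrow> real ^ 'n \<Rightarrow> real ^ 'n ^ 'm" where
  "outer_product u v = (columnvector u :: real ^ 1 ^ 'm) ** (rowvector v :: real ^ 'n ^ 1)"

end

theory Submission
  imports Defs
begin

text \<open>
  For an affine map \<open>q\<close> with linear part \<open>M\<close> the residual is affine as well, so it
  commutes with combinations whose coefficients add up to one; moreover
  \<open>residual q (q y) = M *v residual q y\<close>. Anderson's new iterate is such a combination of
  \<open>q z\<close> and \<open>q y\<close>, where \<open>y\<close> and \<open>z\<close> are the last two iterates. With \<open>u\<close> and \<open>v\<close> the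
  residuals of \<open>y\<close> and \<open>z\<close>, the new residual is therefore \<open>M *v (v + \<beta> *\<^sub>R (v - u))\<close>
  (lemma \<open>residual_AA1_Suc_Suc\<close>).

  If \<open>u \<noteq> v\<close>, the coefficient \<open>\<beta>\<close> minimises \<open>norm (v + \<beta> *\<^sub>R (v - u))\<close>, so the vector
  in parentheses is the component of \<open>v\<close> orthogonal to \<open>v - u\<close>. Up to the factor
  \<open>(v - u) \<bullet> (v - u)\<close> it is the image of \<open>v - u\<close> under the skew-symmetric matrix
  \<open>u v\<^sup>T - v u\<^sup>T\<close>: such a matrix maps every vector \<open>w\<close> into the span of \<open>u\<close> and \<open>v\<close> and
  orthogonally to \<open>w\<close> (lemma \<open>AA1_coeff_orthogonal_part\<close> gives the scaling). If \<open>u = v\<close>,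
  the correction \<open>\<beta> *\<^sub>R (v - u)\<close> vanishes.
\<close>

lemma outer_product_mult_vec: "outer_product u v *v w = (v \<bullet> w) *\<^sub>R u"
  by (vector outer_product_def columnvector_def rowvector_def matrix_matrix_mult_def
      matrix_vector_mult_def inner_vec_def sum_distrib_left sum_distrib_right algebra_simps)

lemma transpose_outer_product: "transpose (outer_product u v) = outer_product v u"
  by (vector outer_product_def columnvector_def rowvector_def matrix_matrix_mult_def
      transpose_def mult.commute)

lemma residual_affine_combination:
  fixes M :: "real ^ 'n ^ 'n"
  assumes q: "\<And>y. q y = M *v y + b"
  shows "residual q ((1 + c) *\<^sub>R z - c *\<^sub>R y) = (1 + c) *\<^sub>R residual q z - c *\<^sub>R residual q y"
  by (simp add: residual_def q matrix_vector_mult_diff_distrib matrix_vector_right_distrib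
      matrix_vector_mult_scaleR algebra_simps)

lemma residual_affine_image:
  fixes M :: "real ^ 'n ^ 'n"
  assumes q: "\<And>y. q y = M *v y + b"
  shows "residual q (q y) = M *v residual q y"
  by (simp add: residual_def q matrix_vector_mult_diff_distrib)

lemma residual_AA1_Suc_Suc:
  fixes M :: "real ^ 'n ^ 'n" and x0 :: "real ^ 'n"
  assumes q: "\<And>y. q y = M *v y + b"
  defines "r \<equiv> \<lambda>k. residual q (AA1 q x0 k)"
  shows "r (Suc (Suc k)) = M *v (r (Suc k) + AA1_coeff (r k) (r (Suc k)) *\<^sub>R (r (Suc k) - r k))"
  unfolding r_def AA1.simps Let_def residual_affine_combination[OF q] residual_affine_image[OF q]
  by (simp add: matrix_vector_mult_diff_distrib matrix_vector_right_distrib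
      matrix_vector_mult_scaleR algebra_simps)

text \<open>
  With \<open>d = v - u\<close>, the left-hand side times \<open>d \<bullet> d\<close> is \<open>(d \<bullet> d) *\<^sub>R v - (v \<bullet> d) *\<^sub>R d\<close>.
  Expanding \<open>d\<close> in the left factor of \<open>d \<bullet> d\<close> and in the last vector makes the two
  terms \<open>(v \<bullet> d) *\<^sub>R v\<close> cancel.
\<close>
lemma AA1_coeff_orthogonal_part:
  assumes "v \<noteq> u"
  shows "v + AA1_coeff u v *\<^sub>R (v - u) =
    (1 / ((v - u) \<bullet> (v - u))) *\<^sub>R ((v \<bullet> (v - u)) *\<^sub>R u - (u \<bullet> (v - u)) *\<^sub>R v)"
proof -
  define d where "d = v - u"
  have nz: "d \<bullet> d \<noteq> 0"
    using assms by (simp add: d_def)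
  have "(v \<bullet> d) *\<^sub>R u - (u \<bullet> d) *\<^sub>R v = (d \<bullet> d) *\<^sub>R v - (v \<bullet> d) *\<^sub>R d"
    by (simp add: d_def inner_diff_left scaleR_diff_left scaleR_diff_right)
  then have "(1 / (d \<bullet> d)) *\<^sub>R ((v \<bullet> d) *\<^sub>R u - (u \<bullet> d) *\<^sub>R v) = v + (- (v \<bullet> d) / (d \<bullet> d)) *\<^sub>R d"
    using nz by (simp add: scaleR_diff_right)
  moreover have "AA1_coeff u v = - (v \<bullet> d) / (d \<bullet> d)"
    using assms by (simp add: AA1_coeff_def d_def power2_norm_eq_inner)
  ultimately show ?thesis
    by (simp add: d_def)
qed

theorem proposition3p1:
  fixes M :: "real ^ 'n ^ 'n" and b x0 :: "real ^ 'n"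
    and q :: "real ^ 'n \<Rightarrow> real ^ 'n" and x r :: "nat \<Rightarrow> real ^ 'n"
  assumes "invertible (mat 1 - M)"
    and "M \<noteq> 0"
    and "\<And>y. q y = M *v y + b"
    and "\<And>k. x k = AA1 q x0 k"
    and "\<And>k. r k = residual q (x k)"
  shows "\<forall>k\<ge>1.
    (r k \<noteq> r (k - 1) \<longrightarrow>
      r (k + 1) = (1 / ((r k - r (k - 1)) \<bullet> (r k - r (k - 1)))) *\<^sub>R
        ((M ** (- outer_product (r k) (r (k - 1)) + transpose (outer_product (r k) (r (k - 1)))))
          *v (r k - r (k - 1)))) \<and>
    (r k = r (k - 1) \<longrightarrow> r (k + 1) = M *v r k)"
proof (intro allI impI)
  fix k :: nat
  assume "k \<ge> 1"
  then obtain j where k: "k = Suc j"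
    by (cases k) auto
  define u where "u = r j"
  define v where "v = r (Suc j)"
  have step: "r (Suc (Suc j)) = M *v (v + AA1_coeff u v *\<^sub>R (v - u))"
    unfolding u_def v_def assms(4,5) by (rule residual_AA1_Suc_Suc[OF assms(3)])
  have skew: "(- outer_product v u + transpose (outer_product v u)) *v w
      = (v \<bullet> w) *\<^sub>R u - (u \<bullet> w) *\<^sub>R v" for w
    using matrix_vector_mult_diff_rdistrib[of "outer_product u v" "outer_product v u" w]
    by (simp add: transpose_outer_product outer_product_mult_vec)
  have "r (Suc (Suc j)) = (1 / ((v - u) \<bullet> (v - u))) *\<^sub>R
      ((M ** (- outer_product v u + transpose (outer_product v u))) *v (v - u))" if "v \<noteq> u"
    unfolding step AA1_coeff_orthogonal_part[OF that] matrix_vector_mul_assoc[symmetric] skew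
    by (rule matrix_vector_mult_scaleR)
  moreover have "r (Suc (Suc j)) = M *v v" if "v = u"
    using step that by simp
  ultimately show "(r k \<noteq> r (k - 1) \<longrightarrow>
      r (k + 1) = (1 / ((r k - r (k - 1)) \<bullet> (r k - r (k - 1)))) *\<^sub>R
        ((M ** (- outer_product (r k) (r (k - 1)) + transpose (outer_product (r k) (r (k - 1)))))
          *v (r k - r (k - 1)))) \<and>
    (r k = r (k - 1) \<longrightarrow> r (k + 1) = M *v r k)"
    by (simp add: k u_def v_def)
qed

end
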